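(* For real $p\ne0$ and real $\alpha,\beta$, consider the two-sided inequality $$\alpha G^p+(1-\alpha)A^p<X^p<\beta G^p+(1-\beta)A^p\qquad\text{for all }a,b>0\text{ with }a\ne b.\tag{$*$}$$ (i) If $p\ge6/5$, then $( * )$ holds if and only if $\alpha\ge1-e^{-p}$ and $\beta\le2/3$. (ii) If $0<p\le1$, then $( * )$ holds if and only if $\alpha\ge2/3$ and $\beta\le1-e^{-p}$. (iii) If $p<0$, then $( * )$ holds if and only if $\alpha\le0$ and $\beta\ge2/3$. (iv) For real $p,q$, the double inequality $$M_p\left(G,A;\tfrac23\right)<X<M_q\left(G,A;\tfrac23\right)$$ holds for all $a,b>0$ with $a\neq b$ if and only if $p\le\ln3$ and $q\ge6/5$.
   Context: For $a,b>0$ with $a\neq b$: $A=\frac{a+b}{2}$, $G=\sqrt{ab}$, $P=\frac{a-b}{2\arcsin\frac{a-b}{a+b}}$ (first Seiffert mean), and $X=A e^{G/P-1}$. For $x,y>0$, $w\in(0,1)$ and real $r$, the weighted power mean of order $r$ is $M_r(x,y;w)=\left(wx^r+(1-w)y^r\right)^{1/r}$ if $r\ne0$, and $M_0(x,y;w)=x^wy^{1-w}$. *)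

theory Defs
  imports Complex_Main
begin

text \<open>
  All means below are meant for positive arguments; \<open>seiffert_mean\<close> and \<open>X_mean\<close> are
  moreover meant for \<open>a \<noteq> b\<close> only (on the diagonal, \<open>seiffert_mean\<close> has the junk value 0).
\<close>

definition arith_mean :: "real \<Rightarrow> real \<Rightarrow> real" where
  "arith_mean a b = (a + b) / 2"

definition geom_mean :: "real \<Rightarrow> real \<Rightarrow> real" where
  "geom_mean a b = sqrt (a * b)"

definition seiffert_mean :: "real \<Rightarrow> real \<Rightarrow> real" where
  "seiffert_mean a b = (a - b) / (2 * arcsin ((a - b) / (a + b)))"

definition X_mean :: "real \<Rightarrow> real \<Rightarrow> real" where
  "X_mean a b = arith_mean a b * exp (geom_mean a b / seiffert_mean a b - 1)"

definition weighted_power_mean :: "real \<Rightarrow> real \<Rightarrow> real \<Rightarrow> real \<Rightarrow> real" where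
  "weighted_power_mean r x y w =
     (if r = 0 then x powr w * y powr (1 - w)
      else (w * x powr r + (1 - w) * y powr r) powr (1 / r))"

definition X_power_bounds :: "real \<Rightarrow> real \<Rightarrow> real \<Rightarrow> bool" where
  "X_power_bounds p \<alpha> \<beta> \<longleftrightarrow>
     (\<forall>a b. 0 < a \<and> 0 < b \<and> a \<noteq> b \<longrightarrow>
        \<alpha> * geom_mean a b powr p + (1 - \<alpha>) * arith_mean a b powr p < X_mean a b powr p \<and>
        X_mean a b powr p < \<beta> * geom_mean a b powr p + (1 - \<beta>) * arith_mean a b powr p)"

end

theory Submission
  imports Defs "HOL-Real_Asymp.Real_Asymp"
begin

text \<open>
  Scaling to \<open>A = 1\<close> and writing \<open>(a - b) / (a + b) = \<plusminus> sin t\<close> with \<open>0 < t < \<pi>/2\<close> gives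
  \<open>G = cos t\<close> and \<open>X = exp (t cot t - 1)\<close>, so every bound concerns the sign of
  \<open>ln (1 + m (cos t)^p) - p t cot t\<close> relative to its limit at \<open>0\<close> or \<open>\<pi>/2\<close>, with \<open>m = 2\<close> for the
  constant \<open>2/3\<close> and \<open>m = e^p - 1\<close> for the constant \<open>1 - e^(-p)\<close>. The derivative of this function has
  the sign of \<open>p (ln (2/m) - ln R - (p - 1) ln cos t)\<close>, where
  \<open>R = 2 (sin t - t cos t) / (t - sin t cos t)\<close> does not depend on \<open>p\<close>. Finally
  \<open>(ln R + k ln cos t)' = tan t (D t - k)\<close>, where \<open>D\<close> decreases strictly from \<open>1/5\<close> to \<open>0\<close>:
  this is the origin of the thresholds \<open>p - 1 = 1/5\<close> and \<open>p - 1 = 0\<close>. For the remaining exponents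
  up to \<open>ln 3\<close> a wrong sign of the gap at one point would produce, by the mean value theorem applied
  twice, points \<open>x < y\<close> with \<open>D x \<le> p - 1 \<le> D y\<close>.
\<close>

section \<open>Taylor bounds\<close>

text \<open>The remainder of order 6 carries the factor sin (t + 3 pi) = - sin t, which is negative
  on (0, pi), so truncating there gives a strict upper bound.\<close>

lemma sin_less_taylor5:
  fixes x :: real
  assumes "0 < x" "x < pi"
  shows "sin x < x - x^3/6 + x^5/120"
proof -
  obtain t where t: "0 < t" "t < x"
    "sin x = (\<Sum>m<6. sin_coeff m * x ^ m) + (sin (t + 1/2 * real 6 * pi) / fact 6) * x ^ 6"
    using Maclaurin_sin_expansion3[of 6 x] assms by auto
  have "t + 1/2 * real 6 * pi = (t + pi) + 2 * pi" by simp
  then have "sin (t + 1/2 * real 6 * pi) = - sin t"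
    by (simp only: sin_periodic sin_periodic_pi)
  moreover have "0 < sin t" using t assms by (intro sin_gt_zero) auto
  ultimately have "(sin (t + 1/2 * real 6 * pi) / fact 6) * x ^ 6 < 0"
    using assms by (simp add: divide_neg_pos mult_neg_pos)
  moreover have "(\<Sum>m<6. sin_coeff m * x ^ m) = x - x^3/6 + x^5/120"
    by (simp add: lessThan_nat_numeral sin_coeff_def fact_numeral)
  ultimately show ?thesis using t(3) by linarith
qed

lemma sin_less_taylor9:
  fixes x :: real
  assumes "0 < x" "x < pi"
  shows "sin x < x - x^3/6 + x^5/120 - x^7/5040 + x^9/362880"
proof -
  obtain t where t: "0 < t" "t < x"
    "sin x = (\<Sum>m<10. sin_coeff m * x ^ m) + (sin (t + 1/2 * real 10 * pi) / fact 10) * x ^ 10"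
    using Maclaurin_sin_expansion3[of 10 x] assms by auto
  have "t + 1/2 * real 10 * pi = ((t + pi) + 2 * pi) + 2 * pi" by simp
  then have "sin (t + 1/2 * real 10 * pi) = - sin t"
    by (simp only: sin_periodic sin_periodic_pi)
  moreover have "0 < sin t" using t assms by (intro sin_gt_zero) auto
  ultimately have "(sin (t + 1/2 * real 10 * pi) / fact 10) * x ^ 10 < 0"
    using assms by (simp add: divide_neg_pos mult_neg_pos)
  moreover have "(\<Sum>m<10. sin_coeff m * x ^ m) = x - x^3/6 + x^5/120 - x^7/5040 + x^9/362880"
    by (simp add: lessThan_nat_numeral sin_coeff_def fact_numeral)
  ultimately show ?thesis using t(3) by linarith
qed

text \<open>The square of 1581/500 = 3.162 is just below 10, and the degree 9 bound for the sine is
  already negative at that point. The estimate later turns t < pi/2 into t^2 < 5/2.\<close>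

lemma pi_squared_less_10: "pi\<^sup>2 < 10"
proof (rule ccontr)
  assume "\<not> pi\<^sup>2 < 10"
  then have "(1581/500)\<^sup>2 < pi\<^sup>2" by (simp add: power2_eq_square)
  then have lt: "1581/500 < pi" using power2_less_imp_less pi_ge_zero by blast
  then have "0 < sin (1581/500 :: real)" by (intro sin_gt_zero) auto
  with sin_less_taylor9[of "1581/500"] lt show False
    by (simp add: eval_nat_numeral)
qed

lemma sin_minus_mult_cos_pos:
  fixes x :: real
  assumes "0 < x" "x < pi"
  shows "0 < sin x - x * cos x"
proof -
  have "(\<lambda>x. sin x - x * cos x) 0 < (\<lambda>x. sin x - x * cos x) x"
  proof (rule DERIV_pos_imp_increasing_open[OF assms(1)])
    fix y assume y: "0 < y" "y < x"
    have "((\<lambda>x. sin x - x * cos x) has_real_derivative y * sin y) (at y)"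
      by (auto intro!: derivative_eq_intros)
    moreover have "y * sin y > 0" using y assms by (simp add: sin_gt_zero)
    ultimately show "\<exists>d. ((\<lambda>x. sin x - x * cos x) has_real_derivative d) (at y) \<and> 0 < d" by blast
  qed (auto intro!: continuous_intros)
  then show ?thesis by simp
qed

text \<open>The derivative of sin x - x cos x is x sin x; the right side is the integral of x times
  the degree 5 bound for the sine.\<close>

lemma sin_minus_mult_cos_less:
  fixes x :: real
  assumes "0 < x" "x < pi"
  shows "sin x - x * cos x < x^3/3 * (1 - x\<^sup>2/10 + x^4/280)"
proof -
  let ?f = "\<lambda>x::real. x^3/3 - x^5/30 + x^7/840 - (sin x - x * cos x)"
  have "?f 0 < ?f x"
  proof (rule DERIV_pos_imp_increasing_open[OF assms(1)])
    fix y assume y: "0 < y" "y < x"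
    have "(?f has_real_derivative y * (y - y^3/6 + y^5/120 - sin y)) (at y)"
      by (rule derivative_eq_intros refl | simp)+ (simp add: field_simps eval_nat_numeral)
    moreover have "y * (y - y^3/6 + y^5/120 - sin y) > 0"
      using y assms sin_less_taylor5[of y] by simp
    ultimately show "\<exists>d. (?f has_real_derivative d) (at y) \<and> 0 < d" by blast
  qed (auto intro!: continuous_intros)
  then show ?thesis by (simp add: field_simps eval_nat_numeral)
qed

lemma minus_sin_mult_cos_pos:
  fixes t :: real
  assumes "0 < t" "t < pi"
  shows "0 < t - sin t * cos t"
proof -
  have "sin t * cos t < sin t * 1"
    using assms cos_monotone_0_pi[of 0 t] by (intro mult_strict_left_mono sin_gt_zero) auto
  also have "\<dots> \<le> t" using assms by (simp add: sin_x_le_x)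
  finally show ?thesis by simp
qed

text \<open>With w = t^2 the cubed factor bounds t - sin t cos t from below, and the other two bound
  sin t cos t - t cos 2t and sin t - t cos t from above, up to powers of t. Both sides agree through
  order w, so w^2 splits off from the difference.\<close>

lemma taylor_polynomial_bound:
  fixes w :: real
  assumes "0 < w" "w < 5/2"
  shows "(1 - 4*w/20 + (4*w)\<^sup>2/840 - (4*w)^3/60480)^3 >
         (1 - 4*w/10 + (4*w)\<^sup>2/280) * (1 - w/10 + w\<^sup>2/280)\<^sup>2" (is "?l > ?r")
proof -
  define v where "v = 5/2 - w"
  have v: "0 < v" using assms by (simp add: v_def)
  \<comment> \<open>Bernstein form of \<open>(?l - ?r) / w\<^sup>2\<close> on \<open>[0, 5/2]\<close>: all coefficients are positive.\<close>
  have "?l - ?r = w^2 * (512/13671875 * v^7 + 4936/24609375 * w * v^6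
      + 777743/1722656250 * w^2 * v^5 + 40514/73828125 * w^3 * v^4
      + 49901689/130232812500 * w^4 * v^3 + 97200851/651164062500 * w^5 * v^2
      + 437599/15627937500 * w^6 * v + 78769589/52744289062500 * w^7)"
    unfolding v_def by (simp add: field_simps eval_nat_numeral)
  also have "\<dots> > 0"
    using v assms by (intro mult_pos_pos add_pos_pos) auto
  finally show ?thesis by simp
qed

text \<open>Equivalent to the negativity of the derivative of \<open>D\<close>.\<close>

lemma key_trig_inequality:
  fixes t :: real
  assumes t: "0 < t" "t < pi/2"
  shows "2 * (sin t * cos t - t * cos (2*t)) * (sin t - t * cos t)\<^sup>2 < (t - sin t * cos t)^3"
proof -
  define w where "w = t\<^sup>2"
  have w: "0 < w" "w < 5/2"
  proof -
    show "0 < w" using t by (simp add: w_def)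
    have "t\<^sup>2 < (pi/2)\<^sup>2" using t by (intro power_strict_mono) auto
    then show "w < 5/2" using pi_squared_less_10 by (simp add: w_def field_simps)
  qed
  let ?A = "1 - 4*w/20 + (4*w)\<^sup>2/840 - (4*w)^3/60480"
  let ?B = "1 - 4*w/10 + (4*w)\<^sup>2/280" and ?C = "1 - w/10 + w\<^sup>2/280"
  \<comment> \<open>By the double angle formula, t - sin t cos t is half of 2t - sin 2t, and sin t
    cos t - t cos 2t is half of sin x - x cos x at x = 2t, so the Taylor bounds apply at 2t <
    pi.\<close>
  have A: "2*t^3/3 * ?A < t - sin t * cos t"
    using sin_less_taylor9[of "2*t"] t sin_double[of t]
    by (simp add: w_def field_simps eval_nat_numeral)
  have B: "sin t * cos t - t * cos (2*t) < 4*t^3/3 * ?B"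
    using sin_minus_mult_cos_less[of "2*t"] t sin_double[of t]
    by (simp add: w_def field_simps eval_nat_numeral)
  have C: "sin t - t * cos t < t^3/3 * ?C"
    using sin_minus_mult_cos_less[of t] t by (simp add: w_def field_simps eval_nat_numeral)
  have C0: "0 < sin t - t * cos t" using sin_minus_mult_cos_pos t by simp
  have B0: "0 < sin t * cos t - t * cos (2*t)"
    using sin_minus_mult_cos_pos[of "2*t"] t sin_double[of t] by simp
  have A0: "0 < ?A"
  proof -
    have "(4*w)^3 / 60480 \<le> (4*w)\<^sup>2/840"
      using w by (simp add: power2_eq_square power3_eq_cube)
    then show ?thesis using w by linarith
  qed
  have "2 * (sin t * cos t - t * cos (2*t)) * (sin t - t * cos t)\<^sup>2
       \<le> 2 * (4*t^3/3 * ?B) * (t^3/3 * ?C)\<^sup>2"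
    using B C B0 C0 by (intro mult_mono power_mono) auto
  also have "\<dots> = (2*t^3/3)^3 * (?B * ?C\<^sup>2)"
    by (simp add: power_mult_distrib power_divide eval_nat_numeral)
  also have "\<dots> < (2*t^3/3)^3 * ?A^3"
    using taylor_polynomial_bound[OF w] t by (intro mult_strict_left_mono) auto
  also have "\<dots> = (2*t^3/3 * ?A)^3"
    by (simp only: power_mult_distrib)
  also have "\<dots> < (t - sin t * cos t)^3"
    using A A0 t by (intro power_strict_mono) auto
  finally show ?thesis .
qed

section \<open>Logarithmic derivative of the ratio deciding signs\<close>

text \<open>A mean value argument with a limit in place of the value at the endpoint. If the
  derivative were negative throughout, f would decrease strictly, and the limit would be at least f
  m > f x for the midpoint m; passing through m keeps the inequality strict in the limit.\<close>

lemma ex_deriv_nonneg_right_of_limit: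
  fixes f f' :: "real \<Rightarrow> real"
  assumes lim: "(f \<longlongrightarrow> l) (at_right a)" and x: "a < x" "l \<le> f x"
    and deriv: "\<And>t. a < t \<Longrightarrow> t \<le> x \<Longrightarrow> (f has_real_derivative f' t) (at t)"
  shows "\<exists>y. a < y \<and> y < x \<and> 0 \<le> f' y"
proof (rule ccontr)
  assume "\<not> ?thesis"
  then have neg: "\<And>y. a < y \<Longrightarrow> y < x \<Longrightarrow> f' y < 0" by force
  have dec: "f z < f y" if "a < y" "y < z" "z \<le> x" for y z
  proof (rule DERIV_neg_imp_decreasing_open[OF that(2)])
    show "\<exists>d. (f has_real_derivative d) (at t) \<and> d < 0" if "y < t" "t < z" for t
      using deriv[of t] neg[of t] that \<open>a < y\<close> \<open>z \<le> x\<close> by auto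
    show "continuous_on {y..z} f"
      using that by (intro continuous_at_imp_continuous_on ballI DERIV_isCont[OF deriv]) auto
  qed
  define m where "m = (a + x) / 2"
  have m: "a < m" "m < x" using x by (auto simp: m_def)
  have "eventually (\<lambda>t. f m \<le> f t) (at_right a)"
    using eventually_at_right_real[OF m(1)] by eventually_elim (use dec m in force)
  then have "f m \<le> l" by (intro tendsto_lowerbound[OF lim]) auto
  with dec[of m x] m x show False by simp
qed

lemma ex_deriv_nonpos_left_of_limit:
  fixes f f' :: "real \<Rightarrow> real"
  assumes lim: "(f \<longlongrightarrow> l) (at_left b)" and x: "x < b" "l \<le> f x"
    and deriv: "\<And>t. x \<le> t \<Longrightarrow> t < b \<Longrightarrow> (f has_real_derivative f' t) (at t)"
  shows "\<exists>y. x < y \<and> y < b \<and> f' y \<le> 0"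
proof -
  have "((\<lambda>t. f (- t)) \<longlongrightarrow> l) (at_right (- b))"
    using lim by (simp add: filterlim_at_left_to_right)
  moreover have "((\<lambda>t. f (- t)) has_real_derivative - f' (- t)) (at t)" if "- b < t" "t \<le> - x" for t
    using DERIV_mirror[of f "f' (- t)" t] deriv[of "- t"] that by simp
  ultimately obtain y where "- b < y" "y < - x" "0 \<le> - f' (- y)"
    using ex_deriv_nonneg_right_of_limit[of "\<lambda>t. f (- t)" l "- b" "- x" "\<lambda>t. - f' (- t)"] x by auto
  then show ?thesis by (intro exI[of _ "- y"]) auto
qed

text \<open>The functions \<open>D\<close> and \<open>R\<close> of the introduction.\<close>

definition ratio_slope :: "real \<Rightarrow> real" where
  "ratio_slope t = t * cos t / (sin t - t * cos t) - 2 * sin t * cos t / (t - sin t * cos t)"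

definition sign_ratio :: "real \<Rightarrow> real" where
  "sign_ratio t = 2 * (sin t - t * cos t) / (t - sin t * cos t)"

lemma denoms_pos:
  assumes "0 < t" "t \<le> pi/2"
  shows "0 < sin t - t * cos t" "0 < t - sin t * cos t" "0 < sign_ratio t"
  using assms sin_minus_mult_cos_pos[of t] minus_sin_mult_cos_pos[of t] pi_gt_zero
  by (auto simp: sign_ratio_def simp del: pi_gt_zero)

text \<open>Clearing the squared denominators turns negativity of this difference into
  \<open>key_trig_inequality\<close>. The endpoint pi/2 is included because
  \<open>ratio_slope\<close> vanishes there, which gives its positivity before pi/2.\<close>

lemma has_real_derivative_ratio_slope:
  assumes t: "0 < t" "t \<le> pi/2"
  shows "(ratio_slope has_real_derivative
     2 * (sin t * cos t - t * cos (2*t)) / (t - sin t * cos t)\<^sup>2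
      - (t - sin t * cos t) / (sin t - t * cos t)\<^sup>2) (at t)"
proof -
  note pos = denoms_pos[OF t]
  have 1: "((\<lambda>t. t * cos t / (sin t - t * cos t)) has_real_derivative
        - ((t - sin t * cos t) / (sin t - t * cos t)\<^sup>2)) (at t)"
  proof -
    have "((\<lambda>t. t * cos t / (sin t - t * cos t)) has_real_derivative
        ((cos t - t * sin t) * (sin t - t * cos t) - t * cos t * (t * sin t)) / (sin t - t * cos t)\<^sup>2) (at t)"
      using pos by (auto intro!: derivative_eq_intros simp: power2_eq_square)
    moreover have "(cos t - t * sin t) * (sin t - t * cos t) - t * cos t * (t * sin t)
        = - (t - sin t * cos t)"
      using sin_cos_squared_add[of t] by algebra
    ultimately show ?thesis by (simp only: minus_divide_left)
  qed
  have 2: "((\<lambda>t. 2 * sin t * cos t / (t - sin t * cos t)) has_real_derivative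
        - (2 * (sin t * cos t - t * cos (2*t)) / (t - sin t * cos t)\<^sup>2)) (at t)"
  proof -
    have "((\<lambda>t. 2 * sin t * cos t / (t - sin t * cos t)) has_real_derivative
        (2 * (cos t ^ 2 - sin t ^ 2) * (t - sin t * cos t) - 2 * sin t * cos t * (1 - (cos t ^ 2 - sin t ^ 2)))
           / (t - sin t * cos t)\<^sup>2) (at t)"
      using pos by (auto intro!: derivative_eq_intros simp: power2_eq_square algebra_simps)
    moreover have "2 * (cos t ^ 2 - sin t ^ 2) * (t - sin t * cos t) - 2 * sin t * cos t * (1 - (cos t ^ 2 - sin t ^ 2))
       = - (2 * (sin t * cos t - t * cos (2*t)))"
      unfolding cos_double by (simp add: algebra_simps)
    ultimately show ?thesis by (simp only: minus_divide_left)
  qed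
  show ?thesis
    unfolding ratio_slope_def[abs_def] using DERIV_diff[OF 1 2] by (simp only: minus_diff_minus minus_diff_eq)
qed

lemma ratio_slope_strict_antimono:
  assumes "0 < x" "x < y" "y \<le> pi/2"
  shows "ratio_slope y < ratio_slope x"
proof (rule DERIV_neg_imp_decreasing_open[OF assms(2)])
  fix t assume t: "x < t" "t < y"
  then have t': "0 < t" "t < pi/2" using assms by auto
  note pos = denoms_pos[OF t'(1) less_imp_le[OF t'(2)]]
  have "2 * (sin t * cos t - t * cos (2*t)) / (t - sin t * cos t)\<^sup>2
      < (t - sin t * cos t) / (sin t - t * cos t)\<^sup>2"
    using key_trig_inequality[OF t'] pos
    by (simp only: zero_less_power divide_less_eq less_divide_eq times_divide_eq_left if_True)
       (simp add: power2_eq_square power3_eq_cube mult.assoc)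
  then show "\<exists>d. (ratio_slope has_real_derivative d) (at t) \<and> d < 0"
    using has_real_derivative_ratio_slope[of t] t' by (intro exI conjI) auto
next
  show "continuous_on {x..y} ratio_slope"
    using assms by (intro continuous_at_imp_continuous_on ballI DERIV_isCont[OF has_real_derivative_ratio_slope]) auto
qed

lemma ratio_slope_tendsto: "(ratio_slope \<longlongrightarrow> 1/5) (at_right 0)"
  unfolding ratio_slope_def by real_asymp

lemma ratio_slope_pos:
  assumes "0 < t" "t < pi/2"
  shows "0 < ratio_slope t"
  using ratio_slope_strict_antimono[of t "pi/2"] assms by (simp add: ratio_slope_def)

text \<open>The limit at 0 bounds the value at t/2 only weakly; the strict decrease from t/2 to t
  makes the bound strict.\<close>

lemma ratio_slope_less:
  assumes "0 < t" "t < pi/2"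
  shows "ratio_slope t < 1/5"
proof -
  have "eventually (\<lambda>x. ratio_slope (t/2) \<le> ratio_slope x) (at_right 0)"
    using eventually_at_right_real[of 0 "t/2"] assms
    by (auto elim!: eventually_mono intro!: less_imp_le ratio_slope_strict_antimono)
  then have "ratio_slope (t/2) \<le> 1/5" by (intro tendsto_lowerbound[OF ratio_slope_tendsto]) auto
  with ratio_slope_strict_antimono[of "t/2" t] assms show ?thesis by simp
qed

section \<open>The logarithm of \<open>sign_ratio\<close> times a power of the cosine\<close>

definition log_ratio :: "real \<Rightarrow> real \<Rightarrow> real" where
  "log_ratio k t = ln (sign_ratio t) + k * ln (cos t)"

lemma has_real_derivative_log_ratio:
  assumes t: "0 < t" "t < pi/2"
  shows "(log_ratio k has_real_derivative tan t * (ratio_slope t - k)) (at t)"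
proof -
  note pos = denoms_pos[OF t(1) less_imp_le[OF t(2)]]
  have c: "0 < cos t" using t by (intro cos_gt_zero) auto
  have "(log_ratio k has_real_derivative
      t * sin t / (sin t - t * cos t) - 2 * (sin t)\<^sup>2 / (t - sin t * cos t) - k * (sin t / cos t)) (at t)"
  proof -
    have 1: "((\<lambda>t. ln (sin t - t * cos t)) has_real_derivative t * sin t / (sin t - t * cos t)) (at t)"
      using pos by (auto intro!: derivative_eq_intros)
    have "1 - (cos t * cos t - sin t * sin t) = 2 * (sin t)\<^sup>2"
      using sin_cos_squared_add[of t] by (simp add: power2_eq_square)
    then have 2: "((\<lambda>t. ln (t - sin t * cos t)) has_real_derivative 2 * (sin t)\<^sup>2 / (t - sin t * cos t)) (at t)"
      using pos by (auto intro!: derivative_eq_intros)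
    have 3: "((\<lambda>t. k * ln (cos t)) has_real_derivative - k * (sin t / cos t)) (at t)"
      using c by (auto intro!: derivative_eq_intros)
    have "((\<lambda>t. ln 2 + ln (sin t - t * cos t) - ln (t - sin t * cos t) + k * ln (cos t)) has_real_derivative
      t * sin t / (sin t - t * cos t) - 2 * (sin t)\<^sup>2 / (t - sin t * cos t) - k * (sin t / cos t)) (at t)"
      using DERIV_add[OF DERIV_diff[OF DERIV_add[OF DERIV_const 1] 2] 3] by simp
    then show ?thesis
    proof (rule has_field_derivative_transform_within_open)
      fix x assume "x \<in> {0<..<pi/2}"
      then show "ln 2 + ln (sin x - x * cos x) - ln (x - sin x * cos x) + k * ln (cos x) = log_ratio k x"
        using denoms_pos[of x] by (simp add: log_ratio_def sign_ratio_def ln_div ln_mult del: right_diff_distrib_numeral)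
    qed (use t in auto)
  qed
  moreover have "t * sin t / (sin t - t * cos t) - 2 * (sin t)\<^sup>2 / (t - sin t * cos t) - k * (sin t / cos t)
      = tan t * (ratio_slope t - k)"
  proof -
    \<comment> \<open>Taking out sin t / cos t leaves k as a bare constant, so the monotonicity of
      \<open>log_ratio k\<close> becomes a comparison of \<open>ratio_slope\<close> with k.\<close>
    have "t * s / U - 2 * s\<^sup>2 / V - k * (s / c) = s / c * (t * c / U - 2 * s * c / V - k)"
      if "c \<noteq> 0" for U V s c :: real
      using that by (simp add: right_diff_distrib power2_eq_square mult_ac)
    then show ?thesis using c by (simp add: ratio_slope_def tan_def)
  qed
  ultimately show ?thesis by simp
qed

text \<open>Near 0, sin t - t cos t ~ t^3/3 and t - sin t cos t ~ 2 t^3/3, so the factor 2 in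
  \<open>sign_ratio\<close> normalises its limit to 1.\<close>

lemma log_ratio_tendsto: "(log_ratio k \<longlongrightarrow> 0) (at_right 0)"
  unfolding log_ratio_def sign_ratio_def by real_asymp

lemma log_ratio_mvt:
  assumes "0 < x" "x < y" "y < pi/2"
  shows "\<exists>z. x < z \<and> z < y \<and> log_ratio k y - log_ratio k x = (y - x) * (tan z * (ratio_slope z - k))"
  using assms by (intro MVT2) (auto intro!: has_real_derivative_log_ratio)

lemma tan_mult_sign_iff:
  assumes "0 < t" "t < pi/2"
  shows "0 \<le> tan t * x \<longleftrightarrow> 0 \<le> x" "tan t * x \<le> 0 \<longleftrightarrow> x \<le> 0"
  using tan_gt_zero[of t] assms by (auto simp: zero_le_mult_iff mult_le_0_iff)

lemma ratio_slope_ge_if_log_ratio_nonneg: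
  assumes "0 < t" "t < pi/2" "0 \<le> log_ratio k t"
  shows "\<exists>y. 0 < y \<and> y < t \<and> k \<le> ratio_slope y"
proof -
  have "\<exists>y. 0 < y \<and> y < t \<and> 0 \<le> tan y * (ratio_slope y - k)"
    using assms by (intro ex_deriv_nonneg_right_of_limit[OF log_ratio_tendsto]) (auto intro!: has_real_derivative_log_ratio)
  then show ?thesis using assms tan_mult_sign_iff(1) by fastforce
qed

lemma ratio_slope_le_if_log_ratio_nonpos:
  assumes "0 < t" "t < pi/2" "log_ratio k t \<le> 0"
  shows "\<exists>y. 0 < y \<and> y < t \<and> ratio_slope y \<le> k"
proof -
  have "\<exists>y. 0 < y \<and> y < t \<and> 0 \<le> - (tan y * (ratio_slope y - k))"
    using assms tendsto_minus[OF log_ratio_tendsto[of k]]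
    by (intro ex_deriv_nonneg_right_of_limit[where l = 0 and f = "\<lambda>t. - log_ratio k t"])
       (auto intro!: DERIV_minus has_real_derivative_log_ratio)
  then show ?thesis using assms tan_mult_sign_iff(2) by fastforce
qed

section \<open>The logarithmic gap and the sign of its slope\<close>

text \<open>For p different from 0 this is the derivative of \<open>log_gap p m\<close> divided by
  p. Leaving the factor p out keeps the formula meaningful at p = 0, where
  \<open>geometric_bound\<close> uses it.\<close>

definition gap_slope :: "real \<Rightarrow> real \<Rightarrow> real \<Rightarrow> real" where
  "gap_slope p m t = (t - sin t * cos t) / (sin t)\<^sup>2
     - m * cos t powr (p - 1) * sin t / (1 + m * cos t powr p)"

definition log_gap :: "real \<Rightarrow> real \<Rightarrow> real \<Rightarrow> real" where
  "log_gap p m t = ln (1 + m * cos t powr p) - p * (t * cos t / sin t)"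

text \<open>Over a positive denominator, sin^2 + cos^2 = 1 reduces the numerator to a positive
  multiple of 2/m - \<open>sign_ratio t\<close> (cos t)^(p-1); logarithms then give
  \<open>log_ratio (p - 1)\<close>. For m = 2 the threshold ln (2/m) is 0, which is the limit of
  \<open>log_ratio\<close> at 0.\<close>

lemma gap_slope_sign:
  assumes t: "0 < t" "t < pi/2" and m: "0 < m"
  shows "0 < gap_slope p m t \<longleftrightarrow> log_ratio (p - 1) t < ln (2/m)" "gap_slope p m t < 0 \<longleftrightarrow> ln (2/m) < log_ratio (p - 1) t"
proof -
  note pos = denoms_pos[OF t(1) less_imp_le[OF t(2)]]
  have c: "0 < cos t" and s: "0 < sin t" using t by (auto intro: cos_gt_zero sin_gt_zero)
  define q where "q = cos t powr (p - 1)"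
  have q: "0 < q" "cos t powr p = cos t * q"
    using c by (auto simp: q_def powr_diff)
  have pq: "0 < 1 + m * (cos t * q)" using c q m by (intro add_pos_pos) auto
  then have den: "0 < (sin t)\<^sup>2 * (1 + m * (cos t * q))"
    using s by simp
  have "gap_slope p m t = ((t - sin t * cos t) * (1 + m * (cos t * q)) - m * q * (sin t)^3)
      / ((sin t)\<^sup>2 * (1 + m * (cos t * q)))"
    using s pq by (simp add: gap_slope_def q(2) q_def[symmetric] diff_divide_distrib power2_eq_square power3_eq_cube)
  also have "(t - sin t * cos t) * (1 + m * (cos t * q)) - m * q * (sin t)^3
      = (t - sin t * cos t) - m * q * (sin t - t * cos t)"
    using sin_cos_squared_add[of t] by algebra
  also have "\<dots> = (t - sin t * cos t) * m / 2 * (2 / m - sign_ratio t * q)"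
    using pos m by (simp add: sign_ratio_def field_simps)
  finally have eq: "gap_slope p m t = (t - sin t * cos t) * m / 2 * (2 / m - sign_ratio t * q)
       / ((sin t)\<^sup>2 * (1 + m * (cos t * q)))" .
  have log_ratio_eq: "log_ratio (p - 1) t = ln (sign_ratio t * q)"
    using pos q(1) c by (simp add: log_ratio_def ln_mult q_def ln_powr)
  have "0 < gap_slope p m t \<longleftrightarrow> sign_ratio t * q < 2 / m" "gap_slope p m t < 0 \<longleftrightarrow> 2 / m < sign_ratio t * q"
    unfolding eq using den pos m
    by (auto simp: zero_less_divide_iff divide_less_0_iff zero_less_mult_iff mult_less_0_iff)
  then show "0 < gap_slope p m t \<longleftrightarrow> log_ratio (p - 1) t < ln (2/m)" "gap_slope p m t < 0 \<longleftrightarrow> ln (2/m) < log_ratio (p - 1) t"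
    using pos q(1) m by (simp_all add: log_ratio_eq)
qed

lemma has_real_derivative_mult_cot:
  fixes t :: real
  assumes "sin t \<noteq> 0"
  shows "((\<lambda>t. t * cos t / sin t) has_real_derivative - ((t - sin t * cos t) / (sin t)\<^sup>2)) (at t)"
proof -
  have "((\<lambda>t. t * cos t / sin t) has_real_derivative
      ((cos t - t * sin t) * sin t - t * cos t * cos t) / (sin t * sin t)) (at t)"
    using assms by (auto intro!: derivative_eq_intros)
  moreover have "(cos t - t * sin t) * sin t - t * cos t * cos t = - (t - sin t * cos t)"
    using sin_cos_squared_add[of t] by algebra
  ultimately show ?thesis by (simp only: minus_divide_left power2_eq_square)
qed

lemma has_real_derivative_log_gap:
  assumes t: "0 < t" "t < pi/2" and m: "0 < m"
  shows "(log_gap p m has_real_derivative p * gap_slope p m t) (at t)"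
proof -
  have c: "0 < cos t" and s: "0 < sin t" using t by (auto intro: cos_gt_zero sin_gt_zero)
  have pos: "0 < 1 + m * cos t powr p" using c m by (intro add_pos_pos) auto
  have "((\<lambda>t. ln (1 + m * cos t powr p)) has_real_derivative
      - (p * (m * cos t powr (p - 1) * sin t / (1 + m * cos t powr p)))) (at t)"
    using c pos by (auto intro!: derivative_eq_intros simp: powr_diff mult_ac)
  from DERIV_diff[OF this DERIV_cmult[OF has_real_derivative_mult_cot, of t p]] s
  show ?thesis by (simp add: log_gap_def[abs_def] gap_slope_def right_diff_distrib)
qed

lemma log_gap_tendsto_0:
  assumes "0 < m"
  shows "(log_gap p m \<longlongrightarrow> ln (1 + m) - p) (at_right 0)"
  unfolding log_gap_def using assms by real_asymp

lemma cos_powr_tendsto_pi_half: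
  fixes p :: real
  assumes "0 < p"
  shows "((\<lambda>t. cos t powr p) \<longlongrightarrow> 0) (at_left (pi/2))"
proof -
  have "(cos \<longlongrightarrow> cos (pi/2)) (at_left (pi/2))" by (intro tendsto_intros)
  moreover have "eventually (\<lambda>t. 0 \<le> cos t) (at_left (pi/2))"
    using eventually_at_left_real[OF pi_half_gt_zero] by eventually_elim (auto intro!: cos_ge_zero)
  ultimately show ?thesis
    using assms by (auto intro!: tendsto_zero_powrI[where b = p])
qed

lemma mult_cot_tendsto_pi_half: "((\<lambda>t. t * cos t / sin t) \<longlongrightarrow> (0::real)) (at_left (pi/2))"
  by (rule tendsto_eq_intros refl | simp)+

lemma log_gap_tendsto_pi_half:
  assumes "0 < p"
  shows "(log_gap p m \<longlongrightarrow> 0) (at_left (pi/2))"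
  unfolding log_gap_def
  by (rule tendsto_eq_intros cos_powr_tendsto_pi_half mult_cot_tendsto_pi_half assms refl | simp)+

text \<open>This lemma and the next three compare the gap at t with its limit at 0 or at pi/2 and
  find a point between with the corresponding slope sign. At 0 the factor p stays in the conclusion
  because p may be negative; at pi/2 the limit requires p > 0.\<close>

lemma gap_slope_nonneg_if_log_gap_ge:
  assumes t: "0 < t" "t < pi/2" and m: "0 < m" and ge: "ln (1 + m) - p \<le> log_gap p m t"
  shows "\<exists>y. 0 < y \<and> y < t \<and> 0 \<le> p * gap_slope p m y"
  using assms by (intro ex_deriv_nonneg_right_of_limit[OF log_gap_tendsto_0]) (auto intro!: has_real_derivative_log_gap)

lemma gap_slope_nonpos_if_log_gap_le:
  assumes t: "0 < t" "t < pi/2" and m: "0 < m" and ge: "log_gap p m t \<le> ln (1 + m) - p"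
  shows "\<exists>y. 0 < y \<and> y < t \<and> p * gap_slope p m y \<le> 0"
proof -
  have "\<exists>y. 0 < y \<and> y < t \<and> 0 \<le> - (p * gap_slope p m y)"
    using assms tendsto_minus[OF log_gap_tendsto_0[OF m, of p]]
    by (intro ex_deriv_nonneg_right_of_limit[where l = "- (ln (1 + m) - p)" and f = "\<lambda>t. - log_gap p m t"])
       (auto intro!: DERIV_minus has_real_derivative_log_gap)
  then show ?thesis by auto
qed

lemma gap_slope_nonpos_if_log_gap_nonneg:
  assumes t: "0 < t" "t < pi/2" and m: "0 < m" and p: "0 < p" and ge: "0 \<le> log_gap p m t"
  shows "\<exists>z. t < z \<and> z < pi/2 \<and> gap_slope p m z \<le> 0"
proof -
  have "\<exists>z. t < z \<and> z < pi/2 \<and> p * gap_slope p m z \<le> 0"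
    using assms by (intro ex_deriv_nonpos_left_of_limit[OF log_gap_tendsto_pi_half])
      (auto intro!: has_real_derivative_log_gap)
  then show ?thesis using p by (auto simp: mult_le_0_iff)
qed

lemma gap_slope_nonneg_if_log_gap_nonpos:
  assumes t: "0 < t" "t < pi/2" and m: "0 < m" and p: "0 < p" and ge: "log_gap p m t \<le> 0"
  shows "\<exists>z. t < z \<and> z < pi/2 \<and> 0 \<le> gap_slope p m z"
proof -
  have "\<exists>z. t < z \<and> z < pi/2 \<and> - (p * gap_slope p m z) \<le> 0"
    using assms tendsto_minus[OF log_gap_tendsto_pi_half[OF p, of m]]
    by (intro ex_deriv_nonpos_left_of_limit[where l = 0 and f = "\<lambda>t. - log_gap p m t"])
      (auto intro!: DERIV_minus has_real_derivative_log_gap)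
  then show ?thesis using p by (auto simp: zero_le_mult_iff)
qed

section \<open>The gap compared with its endpoint limits\<close>

text \<open>A gap at or below its limit at 0 would force \<open>ratio_slope\<close> to reach p - 1
  >= 1/5.\<close>

lemma log_gap_two_gt:
  assumes t: "0 < t" "t < pi/2" and p: "6/5 \<le> p"
  shows "ln 3 - p < log_gap p 2 t"
proof (rule ccontr)
  assume "\<not> ?thesis"
  then obtain y where y: "0 < y" "y < t" "p * gap_slope p 2 y \<le> 0"
    using gap_slope_nonpos_if_log_gap_le[OF t, of 2 p] by auto
  then have "0 \<le> log_ratio (p - 1) y"
    using gap_slope_sign(1)[of y 2 p] t p by (auto simp: mult_le_0_iff)
  then obtain z where "0 < z" "z < y" "p - 1 \<le> ratio_slope z" using ratio_slope_ge_if_log_ratio_nonneg[of y "p - 1"] y t by auto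
  then show False using ratio_slope_less[of z] y t p by auto
qed

text \<open>A negative p reverses the sign passed to \<open>gap_slope\<close>, so here
  \<open>ratio_slope\<close> would have to fall to p - 1 < -1, although it is positive.\<close>

lemma log_gap_two_gt_neg:
  assumes t: "0 < t" "t < pi/2" and p: "p < 0"
  shows "ln 3 - p < log_gap p 2 t"
proof (rule ccontr)
  assume "\<not> ?thesis"
  then obtain y where y: "0 < y" "y < t" "p * gap_slope p 2 y \<le> 0"
    using gap_slope_nonpos_if_log_gap_le[OF t, of 2 p] by auto
  then have "log_ratio (p - 1) y \<le> 0"
    using gap_slope_sign(2)[of y 2 p] t p by (auto simp: mult_le_0_iff)
  then obtain z where "0 < z" "z < y" "ratio_slope z \<le> p - 1" using ratio_slope_le_if_log_ratio_nonpos[of y "p - 1"] y t by auto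
  then show False using ratio_slope_pos[of z] y t p by auto
qed

lemma log_gap_two_less:
  assumes t: "0 < t" "t < pi/2" and p: "0 < p" "p \<le> ln 3"
  shows "log_gap p 2 t < ln 3 - p"
proof (rule ccontr)
  assume ge: "\<not> ?thesis"
  obtain y where y: "0 < y" "y < t" "0 \<le> p * gap_slope p 2 y"
    using gap_slope_nonneg_if_log_gap_ge[OF t, of 2 p] ge by auto
  \<comment> \<open>Here p <= ln 3 enters: the limit ln 3 - p at 0 is nonnegative, so the gap at t
    is also at least its limit 0 at pi/2.\<close>
  obtain z where z: "t < z" "z < pi/2" "gap_slope p 2 z \<le> 0"
    using gap_slope_nonpos_if_log_gap_nonneg[OF t, of 2 p] ge p by auto
  have gy: "log_ratio (p - 1) y \<le> 0" using gap_slope_sign(2)[of y 2 p] y t p by (auto simp: zero_le_mult_iff)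
  have gz: "0 \<le> log_ratio (p - 1) z" using gap_slope_sign(1)[of z 2 p] z t by auto
  obtain a where a: "0 < a" "a < y" "ratio_slope a \<le> p - 1" using ratio_slope_le_if_log_ratio_nonpos[OF y(1) _ gy] y t by auto
  obtain b where b: "y < b" "b < z" "log_ratio (p - 1) z - log_ratio (p - 1) y = (z - y) * (tan b * (ratio_slope b - (p - 1)))"
    using log_ratio_mvt[of y z "p - 1"] y z by auto
  have "0 \<le> tan b * (ratio_slope b - (p - 1))"
    using b gy gz y z t by (smt (verit) mult_pos_neg)
  then have "p - 1 \<le> ratio_slope b" using tan_mult_sign_iff(1)[of b] y z b by auto
  then show False using ratio_slope_strict_antimono[of a b] a b y z by auto
qed

text \<open>Near 0 the values of \<open>ratio_slope\<close> are close to 1/5 > p - 1, so the gap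
  drops below its limit at 0 immediately.\<close>

lemma ex_log_gap_two_less:
  assumes p: "0 < p" "p < 6/5"
  shows "\<exists>t. 0 < t \<and> t < pi/2 \<and> log_gap p 2 t < ln 3 - p"
proof -
  have "eventually (\<lambda>t. p - 1 < ratio_slope t) (at_right 0)"
    using p by (intro order_tendstoD(1)[OF ratio_slope_tendsto]) auto
  then obtain \<delta> where \<delta>: "0 < \<delta>" "\<And>t. 0 < t \<Longrightarrow> t < \<delta> \<Longrightarrow> p - 1 < ratio_slope t"
    by (auto simp: eventually_at_right_field)
  define t where "t = min \<delta> (pi/2) / 2"
  have t: "0 < t" "t < pi/2" "t < \<delta>" using \<delta>(1) by (auto simp: t_def min_def)
  moreover have "log_gap p 2 t < ln 3 - p"
  proof (rule ccontr)
    assume "\<not> ?thesis"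
    then obtain y where y: "0 < y" "y < t" "0 \<le> p * gap_slope p 2 y"
      using gap_slope_nonneg_if_log_gap_ge[OF t(1,2), of 2 p] by auto
    then have "log_ratio (p - 1) y \<le> 0"
      using gap_slope_sign(2)[of y 2 p] t p by (auto simp: zero_le_mult_iff)
    then obtain z where "0 < z" "z < y" "ratio_slope z \<le> p - 1" using ratio_slope_le_if_log_ratio_nonpos[of y "p - 1"] y t by auto
    then show False using \<delta>(2)[of z] y t by auto
  qed
  ultimately show ?thesis by blast
qed

text \<open>For m = e^p - 1 both endpoint limits of the gap are 0. A nonnegative gap gives y < z
  whose \<open>log_ratio\<close> values lie on opposite sides of ln (2/m); this threshold cancels in
  their difference, and the mean value theorem yields \<open>ratio_slope b\<close> >= p - 1 >=
  1/5.\<close>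

lemma log_gap_exp_neg:
  assumes t: "0 < t" "t < pi/2" and p: "6/5 \<le> p"
  shows "log_gap p (exp p - 1) t < 0"
proof (rule ccontr)
  let ?m = "exp p - 1"
  assume ge: "\<not> ?thesis"
  obtain y where y: "0 < y" "y < t" "0 \<le> p * gap_slope p ?m y"
    using gap_slope_nonneg_if_log_gap_ge[OF t, of ?m p] ge p by auto
  obtain z where z: "t < z" "z < pi/2" "gap_slope p ?m z \<le> 0"
    using gap_slope_nonpos_if_log_gap_nonneg[OF t, of ?m p] ge p by auto
  have gy: "log_ratio (p - 1) y \<le> ln (2/?m)" using gap_slope_sign(2)[of y ?m p] y t p by (auto simp: zero_le_mult_iff)
  have gz: "ln (2/?m) \<le> log_ratio (p - 1) z" using gap_slope_sign(1)[of z ?m p] z t p by auto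
  obtain b where b: "y < b" "b < z" "log_ratio (p - 1) z - log_ratio (p - 1) y = (z - y) * (tan b * (ratio_slope b - (p - 1)))"
    using log_ratio_mvt[of y z "p - 1"] y z by auto
  have "0 \<le> tan b * (ratio_slope b - (p - 1))"
    using b gy gz y z t by (smt (verit) mult_pos_neg)
  then have "p - 1 \<le> ratio_slope b" using tan_mult_sign_iff(1)[of b] y z b by auto
  then show False using ratio_slope_less[of b] p b y z by auto
qed

text \<open>With the signs reversed, the same comparison would give \<open>ratio_slope b\<close> <=
  p - 1 <= 0.\<close>

lemma log_gap_exp_pos:
  assumes t: "0 < t" "t < pi/2" and p: "0 < p" "p \<le> 1"
  shows "0 < log_gap p (exp p - 1) t"
proof (rule ccontr)
  let ?m = "exp p - 1"
  assume ge: "\<not> ?thesis"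
  obtain y where y: "0 < y" "y < t" "p * gap_slope p ?m y \<le> 0"
    using gap_slope_nonpos_if_log_gap_le[OF t, of ?m p] ge p by auto
  obtain z where z: "t < z" "z < pi/2" "0 \<le> gap_slope p ?m z"
    using gap_slope_nonneg_if_log_gap_nonpos[OF t, of ?m p] ge p by auto
  have gy: "ln (2/?m) \<le> log_ratio (p - 1) y" using gap_slope_sign(1)[of y ?m p] y t p by (auto simp: mult_le_0_iff)
  have gz: "log_ratio (p - 1) z \<le> ln (2/?m)" using gap_slope_sign(2)[of z ?m p] z t p by auto
  obtain b where b: "y < b" "b < z" "log_ratio (p - 1) z - log_ratio (p - 1) y = (z - y) * (tan b * (ratio_slope b - (p - 1)))"
    using log_ratio_mvt[of y z "p - 1"] y z by auto
  have "tan b * (ratio_slope b - (p - 1)) \<le> 0"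
    using b gy gz y z t by (smt (verit) mult_pos_pos)
  then have "ratio_slope b \<le> p - 1" using tan_mult_sign_iff(2)[of b] y z b by auto
  then show False using ratio_slope_pos[of b] p b y z by auto
qed

text \<open>This is the exponent 0 case. Since \<open>log_gap 0 2\<close> is constant on the
  interval, its derivative in p at p = 0 takes its place, namely 2/3 ln (cos t) - t cot t, whose
  derivative in t is \<open>gap_slope 0 2\<close>.\<close>

lemma geometric_bound:
  fixes t :: real
  assumes t: "0 < t" "t < pi/2"
  shows "2/3 * ln (cos t) < t * cos t / sin t - 1"
proof (rule ccontr)
  let ?f = "\<lambda>t::real. 2/3 * ln (cos t) - t * cos t / sin t"
  assume "\<not> ?thesis"
  then have ge: "-1 \<le> ?f t" by simp
  have "\<exists>y. 0 < y \<and> y < t \<and> 0 \<le> gap_slope 0 2 y"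
  proof (rule ex_deriv_nonneg_right_of_limit[where f = ?f and f' = "gap_slope 0 2", OF _ t(1) ge])
    show "(?f \<longlongrightarrow> -1) (at_right 0)" by real_asymp
    fix y assume "0 < y" "y \<le> t"
    then have y: "0 < cos y" "0 < sin y" using t by (auto intro: cos_gt_zero sin_gt_zero)
    have "((\<lambda>t. 2/3 * ln (cos t)) has_real_derivative - (2 * cos y powr -1 * sin y / 3)) (at y)"
      using y by (auto intro!: derivative_eq_intros simp: powr_minus field_simps)
    from DERIV_diff[OF this has_real_derivative_mult_cot] y
    show "(?f has_real_derivative gap_slope 0 2 y) (at y)" by (simp add: gap_slope_def)
  qed
  then obtain y where y: "0 < y" "y < t" "0 \<le> gap_slope 0 2 y" by blast
  then have "log_ratio (-1) y \<le> 0" using gap_slope_sign(2)[of y 2 0] t by auto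
  then obtain z where "0 < z" "z < y" "ratio_slope z \<le> -1" using ratio_slope_le_if_log_ratio_nonpos[of y "-1"] y t by auto
  then show False using ratio_slope_pos[of z] y t by auto
qed

section \<open>Sharp constants\<close>

lemma ex_angle_means:
  assumes "0 < a" "0 < b" "a \<noteq> b"
  shows "\<exists>t\<in>{0<..<pi/2}. geom_mean a b = arith_mean a b * cos t \<and>
           X_mean a b = arith_mean a b * exp (t * cos t / sin t - 1)"
proof -
  \<comment> \<open>The Seiffert mean is symmetric, as arcsin is odd; the absolute value keeps the
    angle positive for either order of a and b.\<close>
  define x where "x = \<bar>a - b\<bar> / (a + b)"
  define t where "t = arcsin x"
  define A where "A = arith_mean a b"
  have A: "0 < A" "A = (a + b) / 2" using assms by (auto simp: A_def arith_mean_def)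
  have x: "0 < x" "x < 1" using assms by (auto simp: x_def field_simps abs_if)
  have t: "0 < t" "t < pi/2"
    using x arcsin_less_arcsin[of 0 x] arcsin_lt_bounded[of x] by (auto simp: t_def)
  have sin: "sin t = x" using x by (simp add: t_def)
  have "cos t = sqrt (1 - x\<^sup>2)" using x by (simp add: t_def cos_arcsin)
  also have "1 - x\<^sup>2 = a * b / A\<^sup>2"
  proof -
    have "x\<^sup>2 * (a + b)\<^sup>2 = (a - b)\<^sup>2" using assms by (simp add: x_def power_divide)
    then have "(1 - x\<^sup>2) * A\<^sup>2 = a * b"
      unfolding A(2) by (simp add: power_divide left_diff_distrib) (simp add: power2_eq_square algebra_simps)
    then show ?thesis using A(1) by (simp add: eq_divide_eq)
  qed
  also have "sqrt \<dots> = geom_mean a b / A"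
    using A(1) by (simp add: real_sqrt_divide geom_mean_def)
  finally have G: "geom_mean a b = A * cos t" using A(1) by simp
  have "seiffert_mean a b = \<bar>a - b\<bar> / (2 * t)"
  proof (cases "a < b")
    case True
    then have "(a - b) / (a + b) = - x" by (simp add: x_def minus_divide_left)
    then show ?thesis using True x by (simp add: seiffert_mean_def arcsin_minus t_def minus_divide_left)
  qed (simp add: seiffert_mean_def t_def x_def)
  also have "\<bar>a - b\<bar> = 2 * A * sin t" using assms by (simp add: sin x_def A(2))
  finally have "geom_mean a b / seiffert_mean a b = t * cos t / sin t"
    using A(1) t by (simp add: G)
  then have "X_mean a b = A * exp (t * cos t / sin t - 1)"
    by (simp add: X_mean_def A_def)
  with G t show ?thesis unfolding A_def by auto
qed

text \<open>Every angle is realised by a pair with A = 1, which makes the reduction to angles an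
  equivalence.\<close>

lemma means_one_plus_minus_sin:
  assumes "t \<in> {0<..<pi/2}"
  shows "0 < 1 + sin t" "0 < 1 - sin t" "1 + sin t \<noteq> 1 - sin t"
    "arith_mean (1 + sin t) (1 - sin t) = 1"
    "geom_mean (1 + sin t) (1 - sin t) = cos t"
    "X_mean (1 + sin t) (1 - sin t) = exp (t * cos t / sin t - 1)"
proof -
  have s: "0 < sin t" "sin t < 1" and c: "0 < cos t"
    using assms sin_monotone_2pi[of t "pi/2"] by (auto intro: sin_gt_zero cos_gt_zero)
  then show "0 < 1 + sin t" "0 < 1 - sin t" "1 + sin t \<noteq> 1 - sin t" by auto
  show A: "arith_mean (1 + sin t) (1 - sin t) = 1" by (simp add: arith_mean_def)
  have "(1 + sin t) * (1 - sin t) = (cos t)\<^sup>2"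
    using sin_cos_squared_add[of t] by algebra
  then show G: "geom_mean (1 + sin t) (1 - sin t) = cos t"
    using c by (simp add: geom_mean_def)
  have "seiffert_mean (1 + sin t) (1 - sin t) = sin t / t"
    using assms by (simp add: seiffert_mean_def arcsin_sin)
  then show "X_mean (1 + sin t) (1 - sin t) = exp (t * cos t / sin t - 1)"
    using A G by (simp add: X_mean_def mult.commute)
qed

section \<open>The quotient whose range determines the constants\<close>

text \<open>The coefficient c that gives equality c (cos t)^p + (1 - c) = (X/A)^p at the angle
  t.\<close>

definition X_quotient :: "real \<Rightarrow> real \<Rightarrow> real" where
  "X_quotient p t = (1 - exp (p * (t * cos t / sin t - 1))) / (1 - cos t powr p)"

lemma cos_in_unit_interval:
  fixes t :: real
  assumes "t \<in> {0<..<pi/2}"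
  shows "0 < cos t" "cos t < 1"
  using assms cos_monotone_0_pi[of 0 t] by (auto intro: cos_gt_zero)

lemma cos_powr_less_1_iff:
  assumes "t \<in> {0<..<pi/2}"
  shows "cos t powr p < 1 \<longleftrightarrow> 0 < p" "1 < cos t powr p \<longleftrightarrow> p < 0"
  using cos_in_unit_interval[OF assms] by (simp_all add: powr_def mult_less_0_iff zero_less_mult_iff)

lemma X_power_bounds_iff_all_angles:
  "X_power_bounds p \<alpha> \<beta> \<longleftrightarrow>
    (\<forall>t\<in>{0<..<pi/2}. \<alpha> * cos t powr p + (1 - \<alpha>) < exp (p * (t * cos t / sin t - 1)) \<and>
       exp (p * (t * cos t / sin t - 1)) < \<beta> * cos t powr p + (1 - \<beta>))" (is "?L \<longleftrightarrow> ?R")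
proof
  assume L: ?L
  show ?R
  proof
    fix t :: real assume t: "t \<in> {0<..<pi/2}"
    note m = means_one_plus_minus_sin[OF t]
    from L m(1-3) show "\<alpha> * cos t powr p + (1 - \<alpha>) < exp (p * (t * cos t / sin t - 1)) \<and>
       exp (p * (t * cos t / sin t - 1)) < \<beta> * cos t powr p + (1 - \<beta>)"
      unfolding X_power_bounds_def by (metis m(4-6) exp_powr_real mult.commute powr_one_eq_one mult_1_right)
  qed
next
  assume R: ?R
  show ?L
    unfolding X_power_bounds_def
  proof (intro allI impI, elim conjE)
    fix a b :: real assume ab: "0 < a" "0 < b" "a \<noteq> b"
    then obtain t where t: "t \<in> {0<..<pi/2}" and G: "geom_mean a b = arith_mean a b * cos t"
      and X: "X_mean a b = arith_mean a b * exp (t * cos t / sin t - 1)"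
      using ex_angle_means by blast
    define A where "A = arith_mean a b"
    have A: "0 < A" using ab by (simp add: A_def arith_mean_def)
    have Gp: "geom_mean a b powr p = A powr p * cos t powr p"
      using A cos_in_unit_interval[OF t] by (simp add: G A_def powr_mult)
    have Xp: "X_mean a b powr p = A powr p * exp (p * (t * cos t / sin t - 1))"
      using A by (simp add: X A_def powr_mult exp_powr_real mult.commute)
    have "A powr p * (\<alpha> * cos t powr p + (1 - \<alpha>)) < A powr p * exp (p * (t * cos t / sin t - 1))"
      "A powr p * exp (p * (t * cos t / sin t - 1)) < A powr p * (\<beta> * cos t powr p + (1 - \<beta>))"
      using R t A by auto
    then show "\<alpha> * geom_mean a b powr p + (1 - \<alpha>) * arith_mean a b powr p < X_mean a b powr p \<and>
        X_mean a b powr p < \<beta> * geom_mean a b powr p + (1 - \<beta>) * arith_mean a b powr p"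
      unfolding Gp Xp A_def[symmetric] by (simp add: algebra_simps)
  qed
qed

text \<open>Solving for the coefficient divides by 1 - (cos t)^p, which has the sign of p, so a
  negative p exchanges the roles of \<alpha> and \<beta>.\<close>

lemma X_power_bounds_iff_X_quotient:
  shows "0 < p \<Longrightarrow> X_power_bounds p \<alpha> \<beta> \<longleftrightarrow>
      (\<forall>t\<in>{0<..<pi/2}. X_quotient p t < \<alpha>) \<and> (\<forall>t\<in>{0<..<pi/2}. \<beta> < X_quotient p t)"
    and "p < 0 \<Longrightarrow> X_power_bounds p \<alpha> \<beta> \<longleftrightarrow>
      (\<forall>t\<in>{0<..<pi/2}. \<alpha> < X_quotient p t) \<and> (\<forall>t\<in>{0<..<pi/2}. X_quotient p t < \<beta>)"
proof -
  have "x * C + (1 - x) < e \<longleftrightarrow> (1 - e) / (1 - C) < x"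
    "e < x * C + (1 - x) \<longleftrightarrow> x < (1 - e) / (1 - C)" if "C < 1" for x C e :: real
    using that by (simp_all add: pos_divide_less_eq pos_less_divide_eq algebra_simps)
  moreover have "x * C + (1 - x) < e \<longleftrightarrow> x < (1 - e) / (1 - C)"
    "e < x * C + (1 - x) \<longleftrightarrow> (1 - e) / (1 - C) < x" if "1 < C" for x C e :: real
    using that by (simp_all add: neg_divide_less_eq neg_less_divide_eq algebra_simps)
  ultimately show "0 < p \<Longrightarrow> X_power_bounds p \<alpha> \<beta> \<longleftrightarrow>
      (\<forall>t\<in>{0<..<pi/2}. X_quotient p t < \<alpha>) \<and> (\<forall>t\<in>{0<..<pi/2}. \<beta> < X_quotient p t)"
    and "p < 0 \<Longrightarrow> X_power_bounds p \<alpha> \<beta> \<longleftrightarrow>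
      (\<forall>t\<in>{0<..<pi/2}. \<alpha> < X_quotient p t) \<and> (\<forall>t\<in>{0<..<pi/2}. X_quotient p t < \<beta>)"
    unfolding X_power_bounds_iff_all_angles X_quotient_def ball_conj_distrib[symmetric]
    by (auto intro!: ball_cong simp only: cos_powr_less_1_iff)
qed

text \<open>The factor p on both sides records the sign of 1 - (cos t)^p, so one statement serves p
  > 0 and p < 0.\<close>

lemma X_quotient_two_thirds_iff:
  assumes "t \<in> {0<..<pi/2}" "p \<noteq> 0"
  shows "X_quotient p t < 2/3 \<longleftrightarrow> p * log_gap p 2 t < p * (ln 3 - p)" "2/3 < X_quotient p t \<longleftrightarrow> p * (ln 3 - p) < p * log_gap p 2 t"
proof -
  define C where "C = cos t powr p"
  define e where "e = exp (p * (t * cos t / sin t - 1))"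
  have C: "0 < C" "C < 1 \<longleftrightarrow> 0 < p" "1 < C \<longleftrightarrow> p < 0"
    using cos_in_unit_interval[OF assms(1)] cos_powr_less_1_iff[OF assms(1)] by (auto simp: C_def)
  have "log_gap p 2 t - (ln 3 - p) = ln (1 + 2 * C) - ln (3 * e)"
    by (simp add: log_gap_def C_def e_def ln_mult algebra_simps)
  then have "log_gap p 2 t < ln 3 - p \<longleftrightarrow> 1 + 2 * C < 3 * e" "ln 3 - p < log_gap p 2 t \<longleftrightarrow> 3 * e < 1 + 2 * C"
    using C(1) ln_less_cancel_iff[of "1 + 2 * C" "3 * e"] ln_less_cancel_iff[of "3 * e" "1 + 2 * C"]
    by (auto simp: e_def simp del: ln_less_cancel_iff)
  then show "X_quotient p t < 2/3 \<longleftrightarrow> p * log_gap p 2 t < p * (ln 3 - p)" "2/3 < X_quotient p t \<longleftrightarrow> p * (ln 3 - p) < p * log_gap p 2 t"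
    using assms(2) C unfolding X_quotient_def C_def[symmetric] e_def[symmetric]
    by (cases "0 < p"; auto simp: pos_divide_less_eq pos_less_divide_eq
      neg_divide_less_eq neg_less_divide_eq mult_less_cancel_left)+
qed

lemma X_quotient_one_minus_exp_iff:
  assumes "t \<in> {0<..<pi/2}" "0 < p"
  shows "X_quotient p t < 1 - exp (- p) \<longleftrightarrow> log_gap p (exp p - 1) t < 0" "1 - exp (- p) < X_quotient p t \<longleftrightarrow> 0 < log_gap p (exp p - 1) t"
proof -
  define C where "C = cos t powr p"
  define e where "e = exp (p * (t * cos t / sin t))"
  have C: "0 < C" "C < 1"
    using cos_in_unit_interval[OF assms(1)] cos_powr_less_1_iff[OF assms(1)] assms(2) by (auto simp: C_def)
  have e: "exp (p * (t * cos t / sin t - 1)) = e * exp (- p)"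
    by (simp add: e_def exp_add[symmetric] algebra_simps)
  have pos: "0 < 1 + (exp p - 1) * C" using C assms(2) by (intro add_pos_pos mult_pos_pos) auto
  have "log_gap p (exp p - 1) t = ln (1 + (exp p - 1) * C) - ln e"
    by (simp add: log_gap_def C_def e_def)
  then have iff: "log_gap p (exp p - 1) t < 0 \<longleftrightarrow> 1 + (exp p - 1) * C < e" "0 < log_gap p (exp p - 1) t \<longleftrightarrow> e < 1 + (exp p - 1) * C"
    using pos ln_less_cancel_iff[of "1 + (exp p - 1) * C" e] ln_less_cancel_iff[of e "1 + (exp p - 1) * C"]
    by (auto simp: e_def simp del: ln_less_cancel_iff)
  \<comment> \<open>Once the denominator 1 - C is cleared, exp (- p) factors out; what remains is
    the comparison expressed by \<open>log_gap\<close> with m = exp p - 1.\<close>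
  have "1 - e * exp (- p) - (1 - exp (- p)) * (1 - C) = exp (- p) * (1 + (exp p - 1) * C - e)"
    by (simp add: algebra_simps exp_minus)
  then have "1 - e * exp (- p) < (1 - exp (- p)) * (1 - C) \<longleftrightarrow> exp (- p) * (1 + (exp p - 1) * C - e) < 0"
    "(1 - exp (- p)) * (1 - C) < 1 - e * exp (- p) \<longleftrightarrow> 0 < exp (- p) * (1 + (exp p - 1) * C - e)"
    by linarith+
  then show "X_quotient p t < 1 - exp (- p) \<longleftrightarrow> log_gap p (exp p - 1) t < 0" "1 - exp (- p) < X_quotient p t \<longleftrightarrow> 0 < log_gap p (exp p - 1) t"
    unfolding X_quotient_def e iff C_def[symmetric] using C
    by (simp_all add: pos_divide_less_eq pos_less_divide_eq mult_less_0_iff zero_less_mult_iff)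
qed

lemma X_quotient_pos_if_neg:
  assumes "t \<in> {0<..<pi/2}" "p < 0"
  shows "0 < X_quotient p t"
proof -
  have "0 < sin t - t * cos t" "0 < sin t"
    using denoms_pos(1)[of t] assms by (auto intro: sin_gt_zero)
  then have "t * cos t / sin t - 1 < 0" by (simp add: divide_less_eq)
  then have "1 < exp (p * (t * cos t / sin t - 1))" using assms(2) by (simp add: mult_neg_neg)
  then show ?thesis
    using cos_powr_less_1_iff(2)[OF assms(1), of p] assms(2) by (simp add: X_quotient_def divide_neg_neg)
qed

text \<open>Near 0, 1 - t cot t ~ t^2/3 and 1 - cos t ~ t^2/2; the factor p cancels and 2/3
  remains.\<close>

lemma X_quotient_tendsto_0:
  assumes "p \<noteq> 0"
  shows "(X_quotient p \<longlongrightarrow> 2/3) (at_right 0)"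
  unfolding X_quotient_def using assms by real_asymp

lemma X_quotient_tendsto_pi_half_pos:
  assumes "0 < p"
  shows "(X_quotient p \<longlongrightarrow> 1 - exp (- p)) (at_left (pi/2))"
  unfolding X_quotient_def
  by (rule tendsto_eq_intros cos_powr_tendsto_pi_half mult_cot_tendsto_pi_half assms refl | simp)+

lemma eventually_in_first_quadrant:
  "eventually (\<lambda>t::real. t \<in> {0<..<pi/2}) (at_right 0)"
  "eventually (\<lambda>t::real. t \<in> {0<..<pi/2}) (at_left (pi/2))"
  using eventually_at_right_real[OF pi_half_gt_zero] eventually_at_left_real[OF pi_half_gt_zero] by auto

lemma X_quotient_tendsto_pi_half_neg:
  assumes "p < 0"
  shows "(X_quotient p \<longlongrightarrow> 0) (at_left (pi/2))"
proof -
  \<comment> \<open>For p < 0 the power (cos t)^p diverges, so 1 / (1 - (cos t)^p) is rewritten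
    through its reciprocal (cos t)^(-p), which tends to 0.\<close>
  have "((\<lambda>t. (1 - exp (p * (t * cos t / sin t - 1))) * (cos t powr (- p) / (cos t powr (- p) - 1)))
      \<longlongrightarrow> (1 - exp (p * (0 - 1))) * (0 / (0 - 1))) (at_left (pi/2))"
    using assms by (intro tendsto_intros cos_powr_tendsto_pi_half mult_cot_tendsto_pi_half) auto
  then show ?thesis
  proof (rule Lim_transform_eventually[THEN tendsto_eq_rhs])
    show "eventually (\<lambda>t. (1 - exp (p * (t * cos t / sin t - 1))) * (cos t powr (- p) / (cos t powr (- p) - 1)) = X_quotient p t)
        (at_left (pi/2))"
      using eventually_in_first_quadrant(2)
    proof eventually_elim
      case (elim t)
      then have "cos t powr p \<noteq> 0" using cos_in_unit_interval(1)[OF elim] by simp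
      then have "cos t powr (- p) / (cos t powr (- p) - 1) = 1 / (1 - cos t powr p)"
        by (simp add: powr_minus field_simps)
      then show ?case by (simp add: X_quotient_def)
    qed
  qed simp
qed

text \<open>The limit l is approached along G but never attained on S, so strict bounds at all
  points still allow x = l.\<close>

lemma all_greater_iff_le_limit:
  fixes f :: "'a \<Rightarrow> real"
  assumes "(f \<longlongrightarrow> l) G" "eventually (\<lambda>t. t \<in> S) G" "G \<noteq> bot" "\<And>t. t \<in> S \<Longrightarrow> l < f t"
  shows "(\<forall>t\<in>S. x < f t) \<longleftrightarrow> x \<le> l"
proof
  assume "\<forall>t\<in>S. x < f t"
  then have "eventually (\<lambda>t. x \<le> f t) G" using assms(2) by (auto elim!: eventually_mono)
  then show "x \<le> l" using tendsto_lowerbound[OF assms(1)] assms(3) by blast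
qed (use assms(4) in force)

lemma all_less_iff_ge_limit:
  fixes f :: "'a \<Rightarrow> real"
  assumes "(f \<longlongrightarrow> l) G" "eventually (\<lambda>t. t \<in> S) G" "G \<noteq> bot" "\<And>t. t \<in> S \<Longrightarrow> f t < l"
  shows "(\<forall>t\<in>S. f t < x) \<longleftrightarrow> l \<le> x"
  using all_greater_iff_le_limit[of "\<lambda>t. - f t" "- l" G S "- x"] assms by (simp add: tendsto_minus)

text \<open>The quotient lies strictly between its limits: 2/3 at the angle 0 is the infimum, and 1
  - exp (- p) at pi/2 is the supremum. For 0 < p <= 1 the two exchange roles.\<close>

lemma X_power_bounds_iff_ge_6_5:
  assumes p: "6/5 \<le> p"
  shows "X_power_bounds p \<alpha> \<beta> \<longleftrightarrow> \<alpha> \<ge> 1 - exp (- p) \<and> \<beta> \<le> 2/3"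
proof -
  have "(\<forall>t\<in>{0<..<pi/2}. X_quotient p t < \<alpha>) \<longleftrightarrow> \<alpha> \<ge> 1 - exp (- p)"
    using p by (intro all_less_iff_ge_limit[OF X_quotient_tendsto_pi_half_pos eventually_in_first_quadrant(2)])
      (auto simp: X_quotient_one_minus_exp_iff log_gap_exp_neg)
  moreover have "(\<forall>t\<in>{0<..<pi/2}. \<beta> < X_quotient p t) \<longleftrightarrow> \<beta> \<le> 2/3"
    using p by (intro all_greater_iff_le_limit[OF X_quotient_tendsto_0 eventually_in_first_quadrant(1)])
      (use X_quotient_two_thirds_iff(2)[of _ p] log_gap_two_gt[of _ p] in \<open>auto simp: mult_less_cancel_left\<close>)
  ultimately show ?thesis using X_power_bounds_iff_X_quotient(1)[of p] p by simp
qed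

lemma one_less_ln_3: "1 < ln (3::real)"
proof -
  \<comment> \<open>The bound 1 + x + x^2 at x = 1 gives only exp 1 <= 3; at x = 1/4 it gives 21/16,
    whose fourth power is strictly below 3.\<close>
  have "exp (1/4 :: real) \<le> 21/16"
    using exp_bound[of "1/4"] by (simp add: power2_eq_square)
  then have "exp (1/4 :: real) ^ 4 \<le> (21/16) ^ 4" by (intro power_mono) auto
  also have "(21/16) ^ 4 < (3::real)" by (simp add: power4_eq_xxxx)
  also have "exp (1/4 :: real) ^ 4 = exp 1" by (simp add: exp_of_nat_mult[symmetric])
  finally have "exp 1 < (3::real)" .
  then show ?thesis using exp_less_cancel_iff[of 1 "ln 3::real"] by simp
qed

lemma X_power_bounds_iff_le_1:
  assumes p: "0 < p" "p \<le> 1"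
  shows "X_power_bounds p \<alpha> \<beta> \<longleftrightarrow> \<alpha> \<ge> 2/3 \<and> \<beta> \<le> 1 - exp (- p)"
proof -
  have "(\<forall>t\<in>{0<..<pi/2}. X_quotient p t < \<alpha>) \<longleftrightarrow> \<alpha> \<ge> 2/3"
    using p one_less_ln_3 by (intro all_less_iff_ge_limit[OF X_quotient_tendsto_0 eventually_in_first_quadrant(1)])
      (use X_quotient_two_thirds_iff(1)[of _ p] log_gap_two_less[of _ p] in \<open>auto simp: mult_less_cancel_left\<close>)
  moreover have "(\<forall>t\<in>{0<..<pi/2}. \<beta> < X_quotient p t) \<longleftrightarrow> \<beta> \<le> 1 - exp (- p)"
    using p by (intro all_greater_iff_le_limit[OF X_quotient_tendsto_pi_half_pos eventually_in_first_quadrant(2)])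
      (auto simp: X_quotient_one_minus_exp_iff log_gap_exp_pos)
  ultimately show ?thesis using X_power_bounds_iff_X_quotient(1)[of p] p by simp
qed

lemma X_power_bounds_iff_neg:
  assumes p: "p < 0"
  shows "X_power_bounds p \<alpha> \<beta> \<longleftrightarrow> \<alpha> \<le> 0 \<and> \<beta> \<ge> 2/3"
proof -
  have "(\<forall>t\<in>{0<..<pi/2}. X_quotient p t < \<beta>) \<longleftrightarrow> \<beta> \<ge> 2/3"
    using p by (intro all_less_iff_ge_limit[OF X_quotient_tendsto_0 eventually_in_first_quadrant(1)])
      (use X_quotient_two_thirds_iff(1)[of _ p] log_gap_two_gt_neg[of _ p] in \<open>auto simp: mult_less_cancel_left\<close>)
  moreover have "(\<forall>t\<in>{0<..<pi/2}. \<alpha> < X_quotient p t) \<longleftrightarrow> \<alpha> \<le> 0"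
    using p by (intro all_greater_iff_le_limit[OF X_quotient_tendsto_pi_half_neg eventually_in_first_quadrant(2)])
      (auto simp: X_quotient_pos_if_neg)
  ultimately show ?thesis using X_power_bounds_iff_X_quotient(2)[of p] p by simp
qed

section \<open>Comparison with weighted power means\<close>

lemma weighted_power_mean_scale:
  assumes "0 < k" "0 < x" "0 < y" "0 < w" "w < 1"
  shows "weighted_power_mean r (k * x) (k * y) w = k * weighted_power_mean r x y w"
proof (cases "r = 0")
  case True
  have "k powr w * k powr (1 - w) = k" using assms by (simp add: powr_add[symmetric])
  then show ?thesis using assms True by (simp add: weighted_power_mean_def powr_mult mult_ac)
next
  case False
  have "w * (k * x) powr r + (1 - w) * (k * y) powr r = k powr r * (w * x powr r + (1 - w) * y powr r)"
    using assms by (simp add: powr_mult algebra_simps)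
  then show ?thesis
    using assms False by (simp add: weighted_power_mean_def powr_mult powr_powr)
qed

text \<open>The logarithms of M and x differ by (\<open>log_gap r 2 t\<close> - (ln 3 - r)) / r; the
  factor r in the conclusions absorbs the sign of this division.\<close>

lemma weighted_power_mean_less_iff_log_gap:
  assumes t: "t \<in> {0<..<pi/2}" and r: "r \<noteq> 0"
  defines "M \<equiv> weighted_power_mean r (cos t) 1 (2/3)" and "x \<equiv> exp (t * cos t / sin t - 1)"
  shows "M < x \<longleftrightarrow> r * log_gap r 2 t < r * (ln 3 - r)" "x < M \<longleftrightarrow> r * (ln 3 - r) < r * log_gap r 2 t"
proof -
  define C where "C = cos t powr r"
  have C: "0 < C" using cos_in_unit_interval[OF t] by (simp add: C_def)
  have M: "M = ((1 + 2 * C) / 3) powr (1 / r)"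
    using r by (simp add: M_def weighted_power_mean_def C_def algebra_simps add_divide_distrib)
  then have pos: "0 < M" using C by simp
  have "0 < x" by (simp add: x_def)
  have "ln M - ln x = (log_gap r 2 t - (ln 3 - r)) / r"
  proof -
    have "ln M = (ln (1 + 2 * C) - ln 3) / r"
      using C by (simp only: M ln_powr) (simp add: ln_div)
    then show ?thesis using r by (simp add: x_def log_gap_def C_def[symmetric] diff_divide_distrib right_diff_distrib)
  qed
  moreover have "M < x \<longleftrightarrow> ln M - ln x < 0" "x < M \<longleftrightarrow> 0 < ln M - ln x"
    using pos \<open>0 < x\<close> by simp_all
  ultimately show "M < x \<longleftrightarrow> r * log_gap r 2 t < r * (ln 3 - r)" "x < M \<longleftrightarrow> r * (ln 3 - r) < r * log_gap r 2 t"
    using r by (auto simp: divide_less_0_iff zero_less_divide_iff mult_less_cancel_left)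
qed

lemma weighted_power_mean_less_X:
  assumes t: "t \<in> {0<..<pi/2}" and p: "p \<le> ln 3"
  shows "weighted_power_mean p (cos t) 1 (2/3) < exp (t * cos t / sin t - 1)"
proof (cases "p = 0")
  case True
  have "ln (cos t powr (2/3)) < t * cos t / sin t - 1"
    using geometric_bound[of t] t cos_in_unit_interval[OF t] by (simp add: ln_powr)
  then have "cos t powr (2/3) < exp (t * cos t / sin t - 1)"
    using cos_in_unit_interval[OF t] by (metis exp_less_mono exp_ln powr_gt_zero less_irrefl)
  then show ?thesis using True by (simp add: weighted_power_mean_def)
next
  case False
  then show ?thesis
    using t p log_gap_two_less[of t p] log_gap_two_gt_neg[of t p]
    by (cases "0 < p") (auto simp: weighted_power_mean_less_iff_log_gap mult_less_cancel_left)
qed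

lemma all_weighted_power_mean_less_X_iff:
  "(\<forall>t\<in>{0<..<pi/2}. weighted_power_mean p (cos t) 1 (2/3) < exp (t * cos t / sin t - 1)) \<longleftrightarrow> p \<le> ln 3"
proof
  assume *: "\<forall>t\<in>{0<..<pi/2}. weighted_power_mean p (cos t) 1 (2/3) < exp (t * cos t / sin t - 1)"
  show "p \<le> ln 3"
  proof (cases "0 < p")
    case True
    \<comment> \<open>The gap tends to 0 at pi/2, so in the limit this inequality becomes 0 <= ln 3
      - p.\<close>
    have "eventually (\<lambda>t. log_gap p 2 t \<le> ln 3 - p) (at_left (pi/2))"
      using eventually_in_first_quadrant(2)
      by eventually_elim (use * True in \<open>auto simp: weighted_power_mean_less_iff_log_gap intro: less_imp_le\<close>)
    then have "0 \<le> ln 3 - p"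
      by (intro tendsto_upperbound[OF log_gap_tendsto_pi_half[OF True]]) auto
    then show ?thesis by simp
  qed (use one_less_ln_3 in simp)
qed (blast intro: weighted_power_mean_less_X)

lemma all_X_less_weighted_power_mean_iff:
  "(\<forall>t\<in>{0<..<pi/2}. exp (t * cos t / sin t - 1) < weighted_power_mean q (cos t) 1 (2/3)) \<longleftrightarrow> 6/5 \<le> q"
proof
  assume *: "\<forall>t\<in>{0<..<pi/2}. exp (t * cos t / sin t - 1) < weighted_power_mean q (cos t) 1 (2/3)"
  show "6/5 \<le> q"
  proof (rule ccontr)
    assume q: "\<not> 6/5 \<le> q"
    have "\<exists>t\<in>{0<..<pi/2}. weighted_power_mean q (cos t) 1 (2/3) < exp (t * cos t / sin t - 1)"
    proof (cases "0 < q")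
      case True
      then show ?thesis
        using q ex_log_gap_two_less[of q] by (auto simp: weighted_power_mean_less_iff_log_gap)
    next
      case False
      \<comment> \<open>For q <= 0 < ln 3 the opposite inequality holds at every angle; pi/4 is an
        arbitrary choice.\<close>
      then show ?thesis using one_less_ln_3
        by (intro bexI[of _ "pi/4"] weighted_power_mean_less_X) auto
    qed
    with * show False by force
  qed
qed (auto simp: weighted_power_mean_less_iff_log_gap log_gap_two_gt)

lemma power_mean_bounds_iff_all_angles:
  "(\<forall>a b. 0 < a \<and> 0 < b \<and> a \<noteq> b \<longrightarrow>
      weighted_power_mean p (geom_mean a b) (arith_mean a b) (2/3) < X_mean a b \<and>
      X_mean a b < weighted_power_mean q (geom_mean a b) (arith_mean a b) (2/3)) \<longleftrightarrow>
   (\<forall>t\<in>{0<..<pi/2}. weighted_power_mean p (cos t) 1 (2/3) < exp (t * cos t / sin t - 1) \<and>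
      exp (t * cos t / sin t - 1) < weighted_power_mean q (cos t) 1 (2/3))" (is "?L \<longleftrightarrow> ?R")
proof
  assume L: ?L
  show ?R
  proof
    fix t :: real assume t: "t \<in> {0<..<pi/2}"
    note m = means_one_plus_minus_sin[OF t]
    from L m(1-3) show "weighted_power_mean p (cos t) 1 (2/3) < exp (t * cos t / sin t - 1) \<and>
      exp (t * cos t / sin t - 1) < weighted_power_mean q (cos t) 1 (2/3)"
      by (metis m(4-6))
  qed
next
  assume R: ?R
  show ?L
  proof (intro allI impI, elim conjE)
    fix a b :: real assume ab: "0 < a" "0 < b" "a \<noteq> b"
    then obtain t where t: "t \<in> {0<..<pi/2}" and G: "geom_mean a b = arith_mean a b * cos t"
      and X: "X_mean a b = arith_mean a b * exp (t * cos t / sin t - 1)"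
      using ex_angle_means by blast
    have A: "0 < arith_mean a b" using ab by (simp add: arith_mean_def)
    have M: "weighted_power_mean r (geom_mean a b) (arith_mean a b) (2/3)
        = arith_mean a b * weighted_power_mean r (cos t) 1 (2/3)" for r
      using weighted_power_mean_scale[of "arith_mean a b" "cos t" 1 "2/3" r] A cos_in_unit_interval[OF t]
      by (simp add: G)
    show "weighted_power_mean p (geom_mean a b) (arith_mean a b) (2/3) < X_mean a b \<and>
      X_mean a b < weighted_power_mean q (geom_mean a b) (arith_mean a b) (2/3)"
      using R t A unfolding M X by simp
  qed
qed

theorem proposition8:
  shows "(\<forall>p \<alpha> \<beta> :: real. p \<ge> 6 / 5 \<longrightarrow>
            (X_power_bounds p \<alpha> \<beta> \<longleftrightarrow> \<alpha> \<ge> 1 - exp (- p) \<and> \<beta> \<le> 2 / 3))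
       \<and> (\<forall>p \<alpha> \<beta> :: real. 0 < p \<and> p \<le> 1 \<longrightarrow>
            (X_power_bounds p \<alpha> \<beta> \<longleftrightarrow> \<alpha> \<ge> 2 / 3 \<and> \<beta> \<le> 1 - exp (- p)))
       \<and> (\<forall>p \<alpha> \<beta> :: real. p < 0 \<longrightarrow>
            (X_power_bounds p \<alpha> \<beta> \<longleftrightarrow> \<alpha> \<le> 0 \<and> \<beta> \<ge> 2 / 3))
       \<and> (\<forall>p q :: real.
            (\<forall>a b :: real. 0 < a \<and> 0 < b \<and> a \<noteq> b \<longrightarrow>
               weighted_power_mean p (geom_mean a b) (arith_mean a b) (2 / 3) < X_mean a b \<and>
               X_mean a b < weighted_power_mean q (geom_mean a b) (arith_mean a b) (2 / 3))
            \<longleftrightarrow> p \<le> ln 3 \<and> q \<ge> 6 / 5)"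
  using X_power_bounds_iff_ge_6_5 X_power_bounds_iff_le_1 X_power_bounds_iff_neg
  unfolding power_mean_bounds_iff_all_angles ball_conj_distrib
    all_weighted_power_mean_less_X_iff all_X_less_weighted_power_mean_iff
  by simp

end
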